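(* Let $a,r,l>0$ and $$I(a,r,l)=\inf_\mu\int_{\mathbb R\times\mathbb R}(rx^2+lu^2)\,\mu(dx,du),$$ where the infimum is over Borel probability measures $\mu$ on $\mathbb R\times\mathbb R$ satisfying $$\int_{\mathbb R\times\mathbb R}\big(\tfrac12af''(x)+uf'(x)\big)\mu(dx,du)=0\qquad\text{for all }f\in C^2_0(\mathbb R).$$ Then $I(a,r,l)=\sqrt{a^2rl}$, and the optimum is attained by $$\mu^*(dx,du)=\frac1{\sqrt{2\pi}\,\sigma}e^{-\frac{x^2}{2\sigma^2}}dx\otimes\delta_{\{-\theta x\}}(du),\qquad \sigma^2=\frac a{2\theta},\quad\theta=\sqrt{\frac rl}.$$
   Context: $C^2_0(\mathbb R)$ is the set of twice continuously differentiable real functions on $\mathbb R$ with compact support; $\delta_y$ is the Dirac mass at $y$. *)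

theory Defs
  imports "HOL-Probability.Probability"
begin

definition C2_0 :: "(real \<Rightarrow> real) set" where
  "C2_0 = {f. (\<forall>x. f differentiable at x) \<and> (\<forall>x. deriv f differentiable at x)
              \<and> continuous_on UNIV (deriv (deriv f))
              \<and> compact (closure {x. f x \<noteq> 0})}"

(* The integrability conjunct says that the integral in the constraint exists; it is needed
   because the library's integral is 0 for a non-integrable integrand. It holds automatically
   for every measure of finite cost, so it does not affect the infimum below. *)
definition admissible :: "real \<Rightarrow> (real \<times> real) measure set" where
  "admissible a =
     {\<mu>. prob_space \<mu> \<and> sets \<mu> = sets borel \<and>
         (\<forall>f\<in>C2_0.
            integrable \<mu> (\<lambda>(x, u). 1/2 * a * deriv (deriv f) x + u * deriv f x) \<and>
            (\<integral>(x, u). 1/2 * a * deriv (deriv f) x + u * deriv f x \<partial>\<mu>) = 0)}"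

definition cost :: "real \<Rightarrow> real \<Rightarrow> (real \<times> real) measure \<Rightarrow> ennreal" where
  "cost r l \<mu> = (\<integral>\<^sup>+(x, u). ennreal (r * x^2 + l * u^2) \<partial>\<mu>)"

definition I :: "real \<Rightarrow> real \<Rightarrow> real \<Rightarrow> ennreal" where
  "I a r l = (INF \<mu>\<in>admissible a. cost r l \<mu>)"

(* The measure m(dx) K(x, du) on the product space. *)
definition kernel_product ::
    "real measure \<Rightarrow> (real \<Rightarrow> real measure) \<Rightarrow> (real \<times> real) measure" where
  "kernel_product m K = m \<bind> (\<lambda>x. K x \<bind> (\<lambda>u. return borel (x, u)))"

(* The library's "return borel y" is the Dirac mass at y. *)
definition mu_star :: "real \<Rightarrow> real \<Rightarrow> (real \<times> real) measure" where
  "mu_star \<theta> \<sigma> = kernel_product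
     (density lborel (\<lambda>x. ennreal (1 / (sqrt (2 * pi) * \<sigma>) * exp (- (x^2) / (2 * \<sigma>^2)))))
     (\<lambda>x. return borel (- \<theta> * x))"

end

theory Submission
  imports Defs
begin

text \<open>Lower bound: approximating \<open>x\<^sup>2\<close> by compactly supported test functions turns the constraint into
\<open>\<integral> x u d\<mu> = - a / 2\<close> for every \<open>\<mu>\<close> of finite cost, and
\<open>r x\<^sup>2 + l u\<^sup>2 \<ge> - 2 sqrt (r l) x u\<close> pointwise. The measure \<open>\<mu>\<^sup>*\<close> is the image of the normal
distribution under \<open>x \<mapsto> (x, - \<theta> x)\<close>; it is admissible because \<open>(\<sigma>\<^sup>2 f'' - x f') \<rho> = (\<sigma>\<^sup>2 f' \<rho>)'\<close>
for the Gaussian density \<open>\<rho>\<close>, and its cost is \<open>2 r \<sigma>\<^sup>2\<close>.\<close>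

section \<open>Compactly supported truncations of the square function\<close>

lemma DERIV_max_0_power:
  "((\<lambda>t::real. max 0 t ^ (n + 2)) has_real_derivative real (n + 2) * max 0 t ^ (n + 1)) (at t)"
proof -
  consider "t > 0" | "t < 0" | "t = 0" by linarith
  then show ?thesis
  proof cases
    case 1
    have "((\<lambda>t::real. t ^ (n + 2)) has_real_derivative real (n + 2) * max 0 t ^ (n + 1)) (at t)"
      using DERIV_pow[of "n + 2" t UNIV] 1 by simp
    then show ?thesis
      by (rule has_field_derivative_transform_within_open[where S = "{0<..}"]) (use 1 in auto)
  next
    case 2
    have "((\<lambda>t::real. 0) has_real_derivative real (n + 2) * max 0 t ^ (n + 1)) (at t)"
      using 2 by auto
    then show ?thesis
      by (rule has_field_derivative_transform_within_open[where S = "{..<0}"]) (use 2 in auto)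
  next
    case 3
    \<comment> \<open>At the kink the derivative is computed from the difference quotient. The
      exponent offset 2 leaves at least one power of \<open>h\<close> after the division, so the
      quotient tends to 0 from both sides.\<close>
    have "((\<lambda>h::real. max 0 h ^ (n + 2) / h) \<longlongrightarrow> 0) (at 0)"
    proof (rule Lim_null_comparison)
      have "norm (max 0 h ^ (n + 2) / h) \<le> \<bar>h\<bar> ^ (n + 1)" for h :: real
      proof (cases "h > 0")
        case False
        then have "norm (max 0 h ^ (n + 2) / h) = 0" by simp
        also have "\<dots> \<le> \<bar>h\<bar> ^ (n + 1)" by (intro zero_le_power abs_ge_zero)
        finally show ?thesis .
      qed simp
      then show "\<forall>\<^sub>F h in at 0. norm (max 0 h ^ (n + 2) / h :: real) \<le> \<bar>h\<bar> ^ (n + 1)"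
        by simp
      show "((\<lambda>h::real. \<bar>h\<bar> ^ (n + 1)) \<longlongrightarrow> 0) (at 0)"
        by (auto intro!: tendsto_eq_intros)
    qed
    then show ?thesis
      using 3 by (simp add: DERIV_def)
  qed
qed

text \<open>The square times a bump that vanishes for \<open>c * x^2 \<ge> 1\<close>; letting
  \<open>c\<close> tend to 0 recovers the square. For \<open>c > 0\<close> the cube is the lowest
  integer power of the positive part that makes the product twice continuously
  differentiable.\<close>

definition cutoff_square :: "real \<Rightarrow> real \<Rightarrow> real" where
  "cutoff_square c x = x\<^sup>2 * max 0 (1 - c * x\<^sup>2) ^ 3"

definition cutoff_square' :: "real \<Rightarrow> real \<Rightarrow> real" where
  "cutoff_square' c x =
     2 * x * max 0 (1 - c * x\<^sup>2) ^ 3 - 6 * c * x ^ 3 * max 0 (1 - c * x\<^sup>2) ^ 2"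

text \<open>Written so that \<open>x\<close> enters only through \<open>c * x^2\<close>: this scale
  invariance is why a bound independent of \<open>c\<close> is possible.\<close>

definition cutoff_square'' :: "real \<Rightarrow> real \<Rightarrow> real" where
  "cutoff_square'' c x =
     2 * max 0 (1 - c * x\<^sup>2) ^ 3 - 30 * (c * x\<^sup>2) * max 0 (1 - c * x\<^sup>2) ^ 2
     + 24 * (c * x\<^sup>2)\<^sup>2 * max 0 (1 - c * x\<^sup>2)"

lemma DERIV_max_0_quadratic_power:
  "((\<lambda>x. max 0 (1 - c * x\<^sup>2) ^ (n + 2)) has_real_derivative
    real (n + 2) * max 0 (1 - c * x\<^sup>2) ^ (n + 1) * (- 2 * c * x)) (at x)"
proof (rule DERIV_chain2[OF DERIV_max_0_power])
  show "((\<lambda>x. 1 - c * x\<^sup>2) has_real_derivative - 2 * c * x) (at x)"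
    by (auto intro!: derivative_eq_intros)
qed

lemma DERIV_cutoff_square:
  "(cutoff_square c has_real_derivative cutoff_square' c x) (at x)"
proof -
  \<comment> \<open>The exponent 3 is spelled \<open>1 + 2\<close> to match the shape
    \<open>n + 2\<close> of the derivative rule; the same device is used for the next
    derivative.\<close>
  have "((\<lambda>x. x\<^sup>2 * max 0 (1 - c * x\<^sup>2) ^ (1 + 2)) has_real_derivative cutoff_square' c x) (at x)"
    by (rule DERIV_cong[OF DERIV_mult[OF DERIV_pow DERIV_max_0_quadratic_power]])
      (simp add: cutoff_square'_def algebra_simps power2_eq_square power3_eq_cube)
  then show ?thesis
    unfolding cutoff_square_def by (simp only: one_plus_numeral semiring_norm)
qed

lemma DERIV_cutoff_square':
  "(cutoff_square' c has_real_derivative cutoff_square'' c x) (at x)"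
proof -
  have "((\<lambda>x. 2 * x * max 0 (1 - c * x\<^sup>2) ^ (1 + 2) - 6 * c * x ^ 3 * max 0 (1 - c * x\<^sup>2) ^ (0 + 2))
      has_real_derivative cutoff_square'' c x) (at x)"
    by (rule DERIV_cong[OF DERIV_diff[OF
            DERIV_mult[OF DERIV_cmult[OF DERIV_ident] DERIV_max_0_quadratic_power]
            DERIV_mult[OF DERIV_cmult[OF DERIV_pow] DERIV_max_0_quadratic_power]]])
      (simp add: cutoff_square''_def algebra_simps power2_eq_square power3_eq_cube)
  then show ?thesis
    unfolding cutoff_square'_def by (simp only: one_plus_numeral semiring_norm add_0)
qed

lemma deriv_cutoff_square [simp]:
  "deriv (cutoff_square c) = cutoff_square' c" "deriv (cutoff_square' c) = cutoff_square'' c"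
  using DERIV_cutoff_square DERIV_cutoff_square' by (auto intro!: DERIV_imp_deriv)

lemma cutoff_square_in_C2_0:
  assumes "c > 0"
  shows "cutoff_square c \<in> C2_0"
proof -
  have "{x. cutoff_square c x \<noteq> 0} \<subseteq> cball 0 (sqrt (1 / c))"
  proof
    fix x assume "x \<in> {x. cutoff_square c x \<noteq> 0}"
    then have "c * x\<^sup>2 < 1"
      by (auto simp: cutoff_square_def max_def split: if_splits)
    then have "x\<^sup>2 \<le> 1 / c"
      using assms by (simp add: field_simps)
    then have "\<bar>x\<bar> \<le> sqrt (1 / c)"
      using real_le_rsqrt by force
    then show "x \<in> cball 0 (sqrt (1 / c))" by simp
  qed
  then have "bounded {x. cutoff_square c x \<noteq> 0}"
    by (rule bounded_subset[rotated]) simp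
  moreover have "continuous_on UNIV (cutoff_square'' c)"
    unfolding cutoff_square''_def by (intro continuous_intros)
  moreover have "cutoff_square c differentiable at x" "cutoff_square' c differentiable at x" for x
    using DERIV_cutoff_square DERIV_cutoff_square' by (metis real_differentiable_def)+
  ultimately show ?thesis
    by (simp add: C2_0_def compact_closure)
qed

text \<open>With \<open>y = c * x^2\<close> and \<open>m = max 0 (1 - y)\<close>, either
  \<open>m = 0\<close> or both \<open>y\<close> and \<open>m\<close> lie in [0, 1]; hence all
  products of them that contain \<open>m\<close> are at most 1, and 8 = 2 + 6 sums the coefficients.
  What matters later is that the bound does not depend on \<open>c\<close>.\<close>

lemma abs_cutoff_square'_le:
  assumes "c \<ge> 0"
  shows "\<bar>cutoff_square' c x\<bar> \<le> 8 * \<bar>x\<bar>"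
proof -
  define y m where "y = c * x\<^sup>2" and "m = max 0 (1 - y)"
  have "y \<ge> 0" using assms by (simp add: y_def)
  then have m: "0 \<le> m" "m \<le> 1" and ym: "0 \<le> y * m" "y * m \<le> 1"
    by (auto simp: m_def max_def mult_le_one)
  have "cutoff_square' c x = x * (2 * m ^ 3 - 6 * (y * m) * m)"
    by (simp add: cutoff_square'_def m_def y_def algebra_simps power2_eq_square power3_eq_cube)
  moreover have "\<bar>2 * m ^ 3 - 6 * (y * m) * m\<bar> \<le> 8"
  proof -
    have "m ^ 3 \<le> 1" "m ^ 3 \<ge> 0" "(y * m) * m \<le> 1" "(y * m) * m \<ge> 0"
      using m ym by (auto intro: power_le_one mult_le_one mult_nonneg_nonneg)
    then show ?thesis by linarith
  qed
  then have "\<bar>x\<bar> * \<bar>2 * m ^ 3 - 6 * (y * m) * m\<bar> \<le> \<bar>x\<bar> * 8"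
    by (intro mult_left_mono) auto
  ultimately show ?thesis by (simp add: abs_mult mult.commute)
qed

text \<open>The same argument, with 56 = 2 + 30 + 24.\<close>

lemma abs_cutoff_square''_le:
  assumes "c \<ge> 0"
  shows "\<bar>cutoff_square'' c x\<bar> \<le> 56"
proof -
  define y m where "y = c * x\<^sup>2" and "m = max 0 (1 - y)"
  have "y \<ge> 0" using assms by (simp add: y_def)
  then have m: "0 \<le> m" "m \<le> 1" and ym: "0 \<le> y * m" "y * m \<le> 1"
    and yym: "0 \<le> y * (y * m)" "y * (y * m) \<le> 1"
    by (auto simp: m_def max_def mult_le_one)
  have "cutoff_square'' c x = 2 * m ^ 3 - 30 * ((y * m) * m) + 24 * (y * (y * m))"
    by (simp add: cutoff_square''_def m_def y_def algebra_simps power2_eq_square)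
  moreover have "m ^ 3 \<le> 1" "m ^ 3 \<ge> 0" "(y * m) * m \<le> 1" "(y * m) * m \<ge> 0"
    using m ym by (auto intro: power_le_one mult_le_one mult_nonneg_nonneg)
  ultimately show ?thesis using yym by linarith
qed

section \<open>Passage to the limit in the constraint, and the lower bound\<close>

lemma tendsto_cutoff_square:
  assumes "c \<longlonglongrightarrow> 0"
  shows "(\<lambda>n. cutoff_square' (c n) x) \<longlonglongrightarrow> 2 * x" "(\<lambda>n. cutoff_square'' (c n) x) \<longlonglongrightarrow> 2"
  unfolding cutoff_square'_def cutoff_square''_def
  by (rule tendsto_eq_intros assms refl | simp)+

text \<open>Testing the constraint formally with \<open>f x = x^2\<close> makes its integrand
  \<open>a + 2 * x * u\<close>, which must then have integral 0. The square is not compactly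
  supported, so the constraint is used for its truncations and dominated convergence passes to the
  limit.\<close>

lemma admissible_second_moment:
  fixes \<mu> :: "(real \<times> real) measure"
  assumes adm: "\<mu> \<in> admissible a" and int: "integrable \<mu> (\<lambda>(x, u). x * u)"
  shows "(\<integral>(x, u). x * u \<partial>\<mu>) = - a / 2"
proof -
  interpret prob_space \<mu> using adm by (simp add: admissible_def)
  have [measurable_cong]: "sets \<mu> = sets (borel \<Otimes>\<^sub>M borel)"
    unfolding borel_prod using adm by (simp add: admissible_def)
  \<comment> \<open>The parameter \<open>c = 1 / (n + 1)\<close> is positive, as membership in
    \<open>C2_0\<close> demands, and tends to 0.\<close>
  define F where "F n = (\<lambda>(x, u). 1/2 * a * cutoff_square'' (inverse (real (Suc n))) x
      + u * cutoff_square' (inverse (real (Suc n))) x)" for n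
  have "(\<integral>z. F n z \<partial>\<mu>) = 0" for n
    using adm cutoff_square_in_C2_0[of "inverse (real (Suc n))"]
    by (fastforce simp: admissible_def F_def)
  moreover have "(\<lambda>n. \<integral>z. F n z \<partial>\<mu>) \<longlonglongrightarrow> (\<integral>(x, u). a + 2 * (x * u) \<partial>\<mu>)"
  proof (rule integral_dominated_convergence)
    show "F n \<in> borel_measurable \<mu>" for n
      unfolding F_def cutoff_square'_def cutoff_square''_def by measurable
    show "(\<lambda>(x, u). a + 2 * (x * u)) \<in> borel_measurable \<mu>" by measurable
    \<comment> \<open>The dominating function: 28 is half of the bound 56 on the second derivative,
      and 8 comes from the bound on the first. The constant is integrable because \<mu> is a
      probability measure.\<close>
    show "integrable \<mu> (\<lambda>z. 28 * \<bar>a\<bar> + 8 * \<bar>case z of (x, u) \<Rightarrow> x * u\<bar>)"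
      using int by auto
    show "AE z in \<mu>. (\<lambda>n. F n z) \<longlonglongrightarrow> (case z of (x, u) \<Rightarrow> a + 2 * (x * u))"
    proof (rule AE_I2, clarify)
      fix x u :: real
      note L = tendsto_cutoff_square[OF LIMSEQ_inverse_real_of_nat, of x]
      have "(\<lambda>n. F n (x, u)) \<longlonglongrightarrow> 1/2 * a * 2 + u * (2 * x)"
        unfolding F_def prod.case by (intro tendsto_intros L)
      then show "(\<lambda>n. F n (x, u)) \<longlonglongrightarrow> a + 2 * (x * u)" by (simp add: algebra_simps)
    qed
    show "AE z in \<mu>. norm (F n z) \<le> 28 * \<bar>a\<bar> + 8 * \<bar>case z of (x, u) \<Rightarrow> x * u\<bar>" for n
    proof (rule AE_I2, clarify)
      fix x u :: real
      let ?c = "inverse (real (Suc n))"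
      have "\<bar>a\<bar> * \<bar>cutoff_square'' ?c x\<bar> \<le> \<bar>a\<bar> * 56" "\<bar>u\<bar> * \<bar>cutoff_square' ?c x\<bar> \<le> \<bar>u\<bar> * (8 * \<bar>x\<bar>)"
        by (intro mult_left_mono abs_cutoff_square''_le abs_cutoff_square'_le; simp)+
      then show "norm (F n (x, u)) \<le> 28 * \<bar>a\<bar> + 8 * \<bar>x * u\<bar>"
        unfolding F_def prod.case real_norm_def
        by (intro order_trans[OF abs_triangle_ineq]) (simp add: abs_mult algebra_simps)
    qed
  qed
  ultimately have "(\<integral>(x, u). a + 2 * (x * u) \<partial>\<mu>) = 0"
    by (simp add: LIMSEQ_const_iff)
  moreover have "(\<integral>(x, u). a + 2 * (x * u) \<partial>\<mu>) = a + 2 * (\<integral>(x, u). x * u \<partial>\<mu>)"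
  proof -
    have "(\<integral>z. a + 2 * (case z of (x, u) \<Rightarrow> x * u) \<partial>\<mu>) = a + 2 * (\<integral>(x, u). x * u \<partial>\<mu>)"
      using int by (subst Bochner_Integration.integral_add) (auto simp: prob_space)
    then show ?thesis by (simp add: case_prod_unfold)
  qed
  ultimately show ?thesis by simp
qed

text \<open>The inequality of arithmetic and geometric means serves twice: it makes
  \<open>x * u\<close> integrable when the cost is finite, so that its moment is known, and it
  bounds the cost from below by that moment. Infinite cost is trivial.\<close>

lemma cost_lower_bound:
  assumes adm: "\<mu> \<in> admissible a" and "a > 0" "r > 0" "l > 0"
  shows "ennreal (a * sqrt (r * l)) \<le> cost r l \<mu>"
proof (cases "cost r l \<mu> = \<infinity>")
  case False
  interpret prob_space \<mu> using adm by (simp add: admissible_def)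
  have [measurable_cong]: "sets \<mu> = sets (borel \<Otimes>\<^sub>M borel)"
    unfolding borel_prod using adm by (simp add: admissible_def)
  let ?q = "\<lambda>(x, u). r * x\<^sup>2 + l * u\<^sup>2 :: real"
  have cost_eq: "cost r l \<mu> = (\<integral>\<^sup>+z. ennreal (?q z) \<partial>\<mu>)"
    by (simp add: cost_def case_prod_unfold)
  have q_nonneg: "?q z \<ge> 0" for z
    using assms by (auto simp: case_prod_unfold)
  have intq: "integrable \<mu> ?q"
  proof (rule integrableI_nonneg)
    show "(\<integral>\<^sup>+z. ennreal (?q z) \<partial>\<mu>) < \<infinity>"
      using False by (simp add: cost_eq top.not_eq_extremum)
  qed (use q_nonneg in auto)
  have pos: "sqrt (r * l) > 0" using assms by simp
  have amgm: "2 * sqrt (r * l) * \<bar>x * u\<bar> \<le> r * x\<^sup>2 + l * u\<^sup>2" for x u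
  proof -
    have "0 \<le> (sqrt r * \<bar>x\<bar> - sqrt l * \<bar>u\<bar>)\<^sup>2" by simp
    also have "\<dots> = r * x\<^sup>2 + l * u\<^sup>2 - 2 * sqrt (r * l) * \<bar>x * u\<bar>"
      using assms by (simp add: power2_diff power_mult_distrib real_sqrt_mult abs_mult)
    finally show ?thesis by simp
  qed
  have intxu: "integrable \<mu> (\<lambda>(x, u). x * u)"
  proof (rule Bochner_Integration.integrable_bound)
    show "integrable \<mu> (\<lambda>z. ?q z / (2 * sqrt (r * l)))" using intq by simp
    show "AE z in \<mu>. norm (case z of (x, u) \<Rightarrow> x * u) \<le> norm (?q z / (2 * sqrt (r * l)))"
    proof (rule AE_I2, clarify)
      fix x u
      show "norm (x * u) \<le> norm ((r * x\<^sup>2 + l * u\<^sup>2) / (2 * sqrt (r * l)))"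
        using amgm[of x u] pos q_nonneg[of "(x, u)"] by (simp add: field_simps abs_mult)
    qed
  qed measurable
  \<comment> \<open>The sign is negative because the mixed moment is \<open>- a / 2\<close>. The
    pointwise bound below is an equality exactly where \<open>sqrt r * x = - sqrt l * u\<close>,
    that is, on the line \<open>u = - sqrt (r / l) * x\<close> that carries the optimal
    measure.\<close>
  have "a * sqrt (r * l) = (\<integral>z. - 2 * sqrt (r * l) * (case z of (x, u) \<Rightarrow> x * u) \<partial>\<mu>)"
    using admissible_second_moment[OF adm intxu] by simp
  also have "\<dots> \<le> (\<integral>z. ?q z \<partial>\<mu>)"
  proof (rule integral_mono)
    fix z :: "real \<times> real"
    obtain x u where z: "z = (x, u)" by (cases z)
    have "sqrt (r * l) * (- (x * u)) \<le> sqrt (r * l) * \<bar>x * u\<bar>"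
      using pos by (intro mult_left_mono) auto
    then show "- 2 * sqrt (r * l) * (case z of (x, u) \<Rightarrow> x * u) \<le> ?q z"
      using amgm[of x u] by (simp add: z)
  qed (use intq intxu in auto)
  finally show ?thesis
    using q_nonneg by (simp add: cost_eq nn_integral_eq_integral[OF intq] ennreal_leI)
qed simp

section \<open>Gaussian integration by parts\<close>

lemma deriv_eq_0_on_open:
  fixes f :: "real \<Rightarrow> real"
  assumes "open S" "\<And>x. x \<in> S \<Longrightarrow> f x = 0" "x \<in> S"
  shows "deriv f x = 0"
proof -
  have "(f has_real_derivative 0) (at x)"
    by (rule has_field_derivative_transform_within_open[where f = "\<lambda>_. 0" and S = S])
      (use assms in auto)
  then show ?thesis by (rule DERIV_imp_deriv)
qed

lemma DERIV_normal_density: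
  assumes "\<sigma> > 0"
  shows "(normal_density 0 \<sigma> has_real_derivative - x / \<sigma>\<^sup>2 * normal_density 0 \<sigma> x) (at x)"
  unfolding normal_density_def using assms
  by (auto intro!: derivative_eq_intros simp: field_simps power2_eq_square)

text \<open>Stein's identity for \<open>deriv f\<close>. The integrand has the antiderivative
  \<open>?F\<close>, and both vanish outside a bounded set, so the integral reduces to an interval
  whose boundary terms are 0.\<close>

lemma has_bochner_integral_Stein_C2_0:
  assumes f: "f \<in> C2_0" and "\<sigma> > 0"
  shows "has_bochner_integral lborel
    (\<lambda>x. normal_density 0 \<sigma> x * (\<sigma>\<^sup>2 * deriv (deriv f) x - x * deriv f x)) 0"
proof -
  let ?h = "\<lambda>x. normal_density 0 \<sigma> x * (\<sigma>\<^sup>2 * deriv (deriv f) x - x * deriv f x)"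
  have D2: "(deriv f has_real_derivative deriv (deriv f) x) (at x)" for x
    using f by (simp add: C2_0_def DERIV_deriv_iff_real_differentiable)
  have cont': "continuous_on UNIV (deriv f)"
    by (intro continuous_at_imp_continuous_on ballI DERIV_isCont[OF D2])
  obtain R where R: "\<And>x. f x \<noteq> 0 \<Longrightarrow> \<bar>x\<bar> < R" and "R > 0"
  proof -
    have "bounded {x. f x \<noteq> 0}"
      using f by (auto simp: C2_0_def intro: bounded_subset[OF compact_imp_bounded closure_subset])
    then show ?thesis
      by (force simp: bounded_pos_less intro: that)
  qed
  define S where "S = {x::real. \<bar>x\<bar> > R}"
  have "open S" unfolding S_def by (intro open_Collect_less continuous_intros)
  have d1: "deriv f x = 0" if "x \<in> S" for x
    using deriv_eq_0_on_open[OF \<open>open S\<close>, of f x] R that by (force simp: S_def)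
  have d2: "deriv (deriv f) x = 0" if "x \<in> S" for x
    using deriv_eq_0_on_open[OF \<open>open S\<close>, of "deriv f" x] d1 that by auto
  \<comment> \<open>\<open>S\<close> is the strict exterior of \<open>[-R, R]\<close>; the extra 1
    puts both endpoints inside \<open>S\<close>, where \<open>deriv f\<close> is known to
    vanish.\<close>
  let ?A = "R + 1"
  let ?F = "\<lambda>x. \<sigma>\<^sup>2 * deriv f x * normal_density 0 \<sigma> x"
  have "has_bochner_integral lborel (\<lambda>x. ?h x * indicator {- ?A .. ?A} x) (?F ?A - ?F (- ?A))"
  proof (rule has_bochner_integral_FTC_Icc_real)
    show "(?F has_real_derivative ?h x) (at x)" for x
      by (rule derivative_eq_intros DERIV_normal_density D2 refl assms)+
        (use \<open>\<sigma> > 0\<close> in \<open>simp add: field_simps\<close>)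
    have "continuous_on UNIV (deriv (deriv f))"
      using f by (simp add: C2_0_def)
    moreover have "continuous_on UNIV (normal_density 0 \<sigma>)"
      by (intro continuous_at_imp_continuous_on ballI DERIV_isCont[OF DERIV_normal_density] assms)
    ultimately have "continuous_on UNIV ?h"
      using cont' by (intro continuous_intros)
    then show "isCont ?h x" for x
      by (simp add: continuous_on_eq_continuous_at)
  qed (use \<open>R > 0\<close> in auto)
  moreover have "(\<lambda>x. ?h x * indicator {- ?A .. ?A} x) = ?h"
  proof
    fix x
    show "?h x * indicator {- ?A .. ?A} x = ?h x"
    proof (cases "x \<in> S")
      case True
      then show ?thesis by (simp add: d1 d2)
    next
      case False
      then have "x \<in> {- ?A .. ?A}" by (auto simp: S_def)
      then show ?thesis by simp
    qed
  qed
  moreover have "deriv f ?A = 0" "deriv f (- ?A) = 0"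
    using \<open>R > 0\<close> by (auto simp: S_def intro!: d1)
  ultimately show ?thesis by simp
qed

section \<open>The optimal measure: representation, admissibility and cost\<close>

lemma graph_borel_measurable:
  fixes \<theta> :: real
  assumes "sets M = sets borel"
  shows "(\<lambda>x. (x, - \<theta> * x)) \<in> M \<rightarrow>\<^sub>M (borel :: (real \<times> real) measure)"
  unfolding measurable_cong_sets[OF assms refl]
  by (intro borel_measurable_continuous_onI continuous_intros)

text \<open>Both kernels are Dirac: the inner bind collapses to the Dirac mass at
  \<open>(x, - \<theta> * x)\<close>, and binding a measure with Dirac masses along a map is the
  push-forward under that map.\<close>

lemma mu_star_eq_distr:
  assumes "\<sigma> > 0"
  shows "mu_star \<theta> \<sigma> = distr (density lborel (normal_density 0 \<sigma>)) borel (\<lambda>x. (x, - \<theta> * x))"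
proof -
  have density: "(\<lambda>x. ennreal (1 / (sqrt (2 * pi) * \<sigma>) * exp (- (x\<^sup>2) / (2 * \<sigma>\<^sup>2))))
      = (\<lambda>x. ennreal (normal_density 0 \<sigma> x))"
    using assms by (simp add: normal_density_def real_sqrt_mult)
  have pair: "(\<lambda>u. (x, u)) \<in> borel \<rightarrow>\<^sub>M (borel :: (real \<times> real) measure)" for x :: real
    by (intro borel_measurable_continuous_onI continuous_intros)
  have "return borel (- \<theta> * x) \<bind> (\<lambda>u. return borel (x, u)) = return borel (x, - \<theta> * x)" for x
    by (rule bind_return[where N = borel])
      (auto intro: measurable_compose[OF pair return_measurable])
  then show ?thesis
    unfolding mu_star_def kernel_product_def density
    by (simp add: bind_return_distr' graph_borel_measurable)
qed

text \<open>On the line \<open>u = - \<theta> * x\<close> the constraint integrand is the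
  Ornstein-Uhlenbeck generator applied to \<open>f\<close>. With
  \<open>a = 2 * \<theta> * \<sigma>^2\<close> it equals \<theta> times
  \<open>\<sigma>^2 * f'' - x * f'\<close>, whose Gaussian integral vanishes by Stein's
  identity.\<close>

lemma mu_star_admissible:
  assumes "\<sigma> > 0" and a: "a = 2 * \<theta> * \<sigma>\<^sup>2"
  shows "mu_star \<theta> \<sigma> \<in> admissible a"
proof -
  have graph: "(\<lambda>x. (x, - \<theta> * x)) \<in> density lborel (normal_density 0 \<sigma>) \<rightarrow>\<^sub>M
      (borel :: (real \<times> real) measure)"
    by (rule graph_borel_measurable) simp
  have "prob_space (mu_star \<theta> \<sigma>)"
    unfolding mu_star_eq_distr[OF \<open>\<sigma> > 0\<close>]
    by (intro prob_space.prob_space_distr prob_space_normal_density assms graph)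
  moreover have "integrable (mu_star \<theta> \<sigma>) (\<lambda>(x, u). 1/2 * a * deriv (deriv f) x + u * deriv f x) \<and>
      (\<integral>(x, u). 1/2 * a * deriv (deriv f) x + u * deriv f x \<partial>mu_star \<theta> \<sigma>) = 0"
    if f: "f \<in> C2_0" for f
  proof -
    have c2: "continuous_on UNIV (deriv (deriv f))" and c1: "continuous_on UNIV (deriv f)"
      using f by (auto simp: C2_0_def continuous_on_eq_continuous_at differentiable_imp_continuous_within)
    note [measurable] = borel_measurable_continuous_onI[OF c1] borel_measurable_continuous_onI[OF c2]
    have meas: "(\<lambda>(x, u). 1/2 * a * deriv (deriv f) x + u * deriv f x) \<in> borel_measurable borel"
      unfolding borel_prod[symmetric] by measurable
    have "has_bochner_integral lborel (\<lambda>x. normal_density 0 \<sigma> x *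
        (1/2 * a * deriv (deriv f) x + (- \<theta> * x) * deriv f x)) (\<theta> * 0)"
      using has_bochner_integral_mult_right[OF has_bochner_integral_Stein_C2_0[OF f \<open>\<sigma> > 0\<close>], of \<theta>]
      by (simp add: a algebra_simps)
    then show ?thesis
      unfolding mu_star_eq_distr[OF \<open>\<sigma> > 0\<close>] integrable_distr_eq[OF graph meas] integral_distr[OF graph meas]
      by (simp add: integrable_density integral_density has_bochner_integral_iff)
  qed
  ultimately show ?thesis
    by (simp add: admissible_def mu_star_eq_distr[OF \<open>\<sigma> > 0\<close>])
qed

lemma cost_mu_star:
  assumes "\<sigma> > 0" "r \<ge> 0" "l \<ge> 0"
  shows "cost r l (mu_star \<theta> \<sigma>) = ennreal ((r + l * \<theta>\<^sup>2) * \<sigma>\<^sup>2)"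
proof -
  have graph: "(\<lambda>x. (x, - \<theta> * x)) \<in> density lborel (normal_density 0 \<sigma>) \<rightarrow>\<^sub>M
      (borel :: (real \<times> real) measure)"
    by (rule graph_borel_measurable) simp
  have meas: "(\<lambda>(x, u). ennreal (r * x\<^sup>2 + l * u\<^sup>2)) \<in> borel_measurable borel"
    unfolding borel_prod[symmetric] by measurable
  \<comment> \<open>The variance, obtained from the formula for the moment of order
    \<open>2 * k\<close> at \<open>k = 1\<close>.\<close>
  have moment: "has_bochner_integral lborel (\<lambda>x. normal_density 0 \<sigma> x * x\<^sup>2) (\<sigma>\<^sup>2)"
    using normal_moment_even[OF \<open>\<sigma> > 0\<close>, of 0 1] by (simp add: power2_eq_square)
  have "cost r l (mu_star \<theta> \<sigma>) =
      (\<integral>\<^sup>+x. ennreal (normal_density 0 \<sigma> x) * ennreal (r * x\<^sup>2 + l * (- \<theta> * x)\<^sup>2) \<partial>lborel)"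
    unfolding cost_def mu_star_eq_distr[OF \<open>\<sigma> > 0\<close>]
    using meas by (subst nn_integral_distr[OF graph]) (simp_all add: nn_integral_density)
  also have "\<dots> = (\<integral>\<^sup>+x. ennreal ((r + l * \<theta>\<^sup>2) * (normal_density 0 \<sigma> x * x\<^sup>2)) \<partial>lborel)"
    by (intro nn_integral_cong)
      (simp add: ennreal_mult'[symmetric] algebra_simps power_mult_distrib)
  also have "\<dots> = ennreal ((r + l * \<theta>\<^sup>2) * \<sigma>\<^sup>2)"
    using has_bochner_integral_mult_right[OF moment, of "r + l * \<theta>\<^sup>2"] assms
    by (subst nn_integral_eq_integral) (auto simp: has_bochner_integral_iff)
  finally show ?thesis .
qed

theorem proposition4p1:
  fixes a r l :: real
  assumes "a > 0" and "r > 0" and "l > 0"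
  shows "I a r l = ennreal (sqrt (a^2 * r * l)) \<and>
         (let \<theta> = sqrt (r / l); \<sigma> = sqrt (a / (2 * \<theta>))
          in mu_star \<theta> \<sigma> \<in> admissible a \<and> cost r l (mu_star \<theta> \<sigma>) = I a r l)"
proof -
  define \<theta> \<sigma> where "\<theta> = sqrt (r / l)" and "\<sigma> = sqrt (a / (2 * \<theta>))"
  have "\<theta> > 0" "\<sigma> > 0" using assms by (auto simp: \<theta>_def \<sigma>_def)
  have \<theta>2: "\<theta>\<^sup>2 = r / l" and \<sigma>2: "\<sigma>\<^sup>2 = a / (2 * \<theta>)"
    using assms \<open>\<theta> > 0\<close> by (auto simp: \<theta>_def \<sigma>_def)
  have val: "sqrt (a^2 * r * l) = a * sqrt (r * l)"
    using assms by (simp add: real_sqrt_mult)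
  have adm: "mu_star \<theta> \<sigma> \<in> admissible a"
    using \<open>\<theta> > 0\<close> \<open>\<sigma> > 0\<close> by (intro mu_star_admissible) (auto simp: \<sigma>2)
  \<comment> \<open>Since \<open>l * \<theta>^2 = r\<close>, state and control contribute equally to
    the cost; the resulting factor \<open>2 * r\<close> cancels the 2 in
    \<open>\<sigma>^2 = a / (2 * \<theta>)\<close>.\<close>
  have "(r + l * \<theta>\<^sup>2) * \<sigma>\<^sup>2 = a * (r / \<theta>)"
    using assms \<open>\<theta> > 0\<close> by (simp add: \<theta>2 \<sigma>2)
  also have "r / \<theta> = sqrt (r * l)"
    using assms by (simp add: \<theta>_def real_sqrt_divide real_sqrt_mult field_simps)
  finally have cost: "cost r l (mu_star \<theta> \<sigma>) = ennreal (a * sqrt (r * l))"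
    using cost_mu_star[of \<sigma> r l \<theta>] assms \<open>\<sigma> > 0\<close> by simp
  have "I a r l = ennreal (a * sqrt (r * l))"
    unfolding I_def
  proof (rule antisym)
    show "(INF \<mu>\<in>admissible a. cost r l \<mu>) \<le> ennreal (a * sqrt (r * l))"
      using INF_lower[OF adm, of "cost r l"] by (simp add: cost)
    show "ennreal (a * sqrt (r * l)) \<le> (INF \<mu>\<in>admissible a. cost r l \<mu>)"
      using assms by (intro INF_greatest cost_lower_bound)
  qed
  then show ?thesis
    using adm cost by (simp add: val \<theta>_def \<sigma>_def Let_def)
qed

end
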